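(* Let $(X,D)$ be an $\mathcal{F}$-metric space with respect to $(f,\alpha)\in\mathcal{F}\times[0,\infty)$, and let $d:X\times X\to[0,\infty)$ be the metric on $X$ defined by $$d(x,y)=\inf\left\{\sum_{i=1}^{N-1}D(u_i,u_{i+1}): N\in\mathbb{N},\ N\ge 2,\ \{u_i\}_{i=1}^{N}\subseteq X \text{ with } (u_1,u_N)=(x,y)\right\}.$$ Then: (i) a sequence $\{x_n\}_{n\in\mathbb{N}}\subseteq X$ is $\mathcal{F}$-Cauchy if and only if it is a Cauchy sequence with respect to the metric $d$; (ii) a sequence $\{x_n\}_{n\in\mathbb{N}}\subseteq X$ is $\mathcal{F}$-convergent to $x\in X$ if and only if it converges to $x$ with respect to the metric $d$; (iii) $X$ is $\mathcal{F}$-complete if and only if $X$ is complete with respect to the metric $d$.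
   Context: Let $\mathcal{F}$ be the set of all functions $f:(0,\infty)\to\mathbb{R}$ satisfying: ($\mathcal{F}_1$) $f$ is non-decreasing, i.e. $0<s<t$ implies $f(s)\le f(t)$; ($\mathcal{F}_2$) for every sequence $\{t_n\}_{n\in\mathbb{N}}\subseteq(0,\infty)$, $\lim_{n\to\infty}t_n=0$ if and only if $\lim_{n\to\infty}f(t_n)=-\infty$. Let $X$ be a non-empty set, $D:X\times X\to[0,\infty)$ a mapping and $(f,\alpha)\in\mathcal{F}\times[0,\infty)$. The pair $(X,D)$ is an $\mathcal{F}$-metric space with respect to $(f,\alpha)$ (and $D$ is an $\mathcal{F}$-metric on $X$) if: (D1) for all $(x,y)\in X\times X$, $D(x,y)=0$ if and only if $x=y$; (D2) $D(x,y)=D(y,x)$ for all $(x,y)\in X\times X$; (D3) for every $(x,y)\in X\times X$, every $N\in\mathbb{N}$ with $N\ge 2$, and every $(u_i)_{i=1}^N\subseteq X$ with $(u_1,u_N)=(x,y)$: if $D(x,y)>0$, then $f(D(x,y))\le f\left(\sum_{i=1}^{N-1}D(u_i,u_{i+1})\right)+\alpha$. For $x\in X$ and $r>0$ put $B_D(x,r)=\{y\in X: D(x,y)<r\}$. The topology $\tau_F$ generated by $D$ consists of all subsets $V\subseteq X$ such that for every $x\in V$ there exists $r>0$ with $B_D(x,r)\subseteq V$. A sequence $\{x_n\}$ in $X$ is $\mathcal{F}$-convergent to $x\in X$ if it converges to $x$ with respect to the topology $\tau_F$. A sequence $\{x_n\}$ in $X$ is $\mathcal{F}$-Cauchy if for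 every $\varepsilon>0$ there exists $K\in\mathbb{N}$ such that $D(x_n,x_m)<\varepsilon$ for all $n,m\ge K$. The space $X$ is $\mathcal{F}$-complete if every $\mathcal{F}$-Cauchy sequence in $X$ is $\mathcal{F}$-convergent to some element of $X$. It is known (Jleli and Samet) that the function $d$ in the claim is a metric on $X$. *)

theory Defs
  imports "HOL-Analysis.Analysis"
begin

text \<open>
  A function from the positive reals to the reals is rendered as a function \<open>real \<Rightarrow> real\<close> of which
  only the values on \<open>{0<..}\<close> are constrained; likewise a function on \<open>X \<times> X\<close> is a curried
  function on the whole type, constrained on the carrier \<open>X\<close> only.
\<close>

definition F_class :: "(real \<Rightarrow> real) set" where
  "F_class = {f. mono_on {0<..} f \<and>
     (\<forall>t :: nat \<Rightarrow> real. (\<forall>n. 0 < t n) \<longrightarrow>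
        (t \<longlonglongrightarrow> 0 \<longleftrightarrow> filterlim (\<lambda>n. f (t n)) at_bot sequentially))}"

text \<open>Chains \<open>u 1, \<dots>, u N\<close> in \<open>X\<close> from \<open>x\<close> to \<open>y\<close>; values of \<open>u\<close> outside \<open>{1..N}\<close> are irrelevant.\<close>

definition is_chain :: "'a set \<Rightarrow> 'a \<Rightarrow> 'a \<Rightarrow> nat \<Rightarrow> (nat \<Rightarrow> 'a) \<Rightarrow> bool" where
  "is_chain X x y N u \<longleftrightarrow> 2 \<le> N \<and> (\<forall>i\<in>{1..N}. u i \<in> X) \<and> u 1 = x \<and> u N = y"

definition chain_sum :: "('a \<Rightarrow> 'a \<Rightarrow> real) \<Rightarrow> nat \<Rightarrow> (nat \<Rightarrow> 'a) \<Rightarrow> real" where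
  "chain_sum D N u = (\<Sum>i = 1..N - 1. D (u i) (u (i + 1)))"

text \<open>
  In \<open>D3\<close> the function \<open>f\<close> is only evaluated at positive arguments: by \<open>D1\<close>, a chain between
  distinct points has positive sum.
\<close>

locale F_metric_space =
  fixes X :: "'a set" and D :: "'a \<Rightarrow> 'a \<Rightarrow> real" and f :: "real \<Rightarrow> real" and \<alpha> :: real
  assumes f_class: "f \<in> F_class"
    and alpha_nonneg: "0 \<le> \<alpha>"
    and X_nonempty: "X \<noteq> {}"
    and D_nonneg: "\<And>x y. x \<in> X \<Longrightarrow> y \<in> X \<Longrightarrow> 0 \<le> D x y"
    and D1: "\<And>x y. x \<in> X \<Longrightarrow> y \<in> X \<Longrightarrow> D x y = 0 \<longleftrightarrow> x = y"
    and D2: "\<And>x y. x \<in> X \<Longrightarrow> y \<in> X \<Longrightarrow> D x y = D y x"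
    and D3: "\<And>x y N u. x \<in> X \<Longrightarrow> y \<in> X \<Longrightarrow> is_chain X x y N u \<Longrightarrow> 0 < D x y \<Longrightarrow>
               f (D x y) \<le> f (chain_sum D N u) + \<alpha>"

definition F_ball :: "'a set \<Rightarrow> ('a \<Rightarrow> 'a \<Rightarrow> real) \<Rightarrow> 'a \<Rightarrow> real \<Rightarrow> 'a set" where
  "F_ball X D x r = {y \<in> X. D x y < r}"

definition F_topology :: "'a set \<Rightarrow> ('a \<Rightarrow> 'a \<Rightarrow> real) \<Rightarrow> 'a topology" where
  "F_topology X D = topology (\<lambda>V. V \<subseteq> X \<and> (\<forall>x\<in>V. \<exists>r>0. F_ball X D x r \<subseteq> V))"

lemma openin_F_topology:
  "openin (F_topology X D) V \<longleftrightarrow> V \<subseteq> X \<and> (\<forall>x\<in>V. \<exists>r>0. F_ball X D x r \<subseteq> V)"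
proof -
  have "istopology (\<lambda>V. V \<subseteq> X \<and> (\<forall>x\<in>V. \<exists>r>0. F_ball X D x r \<subseteq> V))"
    unfolding istopology_def
  proof (intro conjI allI impI ballI)
    fix S T x
    assume S: "S \<subseteq> X \<and> (\<forall>x\<in>S. \<exists>r>0. F_ball X D x r \<subseteq> S)"
      and T: "T \<subseteq> X \<and> (\<forall>x\<in>T. \<exists>r>0. F_ball X D x r \<subseteq> T)"
      and x: "x \<in> S \<inter> T"
    obtain r s where r: "r > 0" "F_ball X D x r \<subseteq> S" and s: "s > 0" "F_ball X D x s \<subseteq> T"
      using S T x by blast
    have "F_ball X D x (min r s) \<subseteq> S \<inter> T"
      using r s by (auto simp: F_ball_def)
    then show "\<exists>r>0. F_ball X D x r \<subseteq> S \<inter> T"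
      using r(1) s(1) by (intro exI[of _ "min r s"]) auto
  next
    fix K x
    assume K: "\<forall>S\<in>K. S \<subseteq> X \<and> (\<forall>x\<in>S. \<exists>r>0. F_ball X D x r \<subseteq> S)" and x: "x \<in> \<Union> K"
    then show "\<exists>r>0. F_ball X D x r \<subseteq> \<Union> K" by (meson UnionE Union_upper subset_trans)
  qed auto
  then show ?thesis by (simp add: F_topology_def topology_inverse')
qed

lemma topspace_F_topology: "topspace (F_topology X D) = X"
proof -
  have "openin (F_topology X D) X"
    unfolding openin_F_topology F_ball_def by (auto intro: exI[of _ 1])
  then show ?thesis
    by (meson openin_F_topology openin_subset openin_topspace subset_antisym)
qed

definition F_convergent :: "'a set \<Rightarrow> ('a \<Rightarrow> 'a \<Rightarrow> real) \<Rightarrow> (nat \<Rightarrow> 'a) \<Rightarrow> 'a \<Rightarrow> bool" where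
  "F_convergent X D \<sigma> x \<longleftrightarrow> limitin (F_topology X D) \<sigma> x sequentially"

definition F_Cauchy :: "'a set \<Rightarrow> ('a \<Rightarrow> 'a \<Rightarrow> real) \<Rightarrow> (nat \<Rightarrow> 'a) \<Rightarrow> bool" where
  "F_Cauchy X D \<sigma> \<longleftrightarrow> range \<sigma> \<subseteq> X \<and> (\<forall>\<epsilon>>0. \<exists>K. \<forall>n\<ge>K. \<forall>m\<ge>K. D (\<sigma> n) (\<sigma> m) < \<epsilon>)"

definition F_complete :: "'a set \<Rightarrow> ('a \<Rightarrow> 'a \<Rightarrow> real) \<Rightarrow> bool" where
  "F_complete X D \<longleftrightarrow> (\<forall>\<sigma>. F_Cauchy X D \<sigma> \<longrightarrow> (\<exists>x\<in>X. F_convergent X D \<sigma> x))"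

text \<open>
  The library locale \<open>Metric_space\<close> demands symmetry and nonnegativity on the whole type, and there
  are no chains between points outside \<open>X\<close>; the value \<open>0\<close> there is a dummy.
\<close>

definition chain_dist :: "'a set \<Rightarrow> ('a \<Rightarrow> 'a \<Rightarrow> real) \<Rightarrow> 'a \<Rightarrow> 'a \<Rightarrow> real" where
  "chain_dist X D x y =
     (if x \<in> X \<and> y \<in> X then Inf {chain_sum D N u |N u. is_chain X x y N u} else 0)"

context F_metric_space
begin

lemma chain_sum_nonneg: "is_chain X x y N u \<Longrightarrow> 0 \<le> chain_sum D N u"
  unfolding is_chain_def chain_sum_def by (intro sum_nonneg D_nonneg) auto

lemma chain_sum_pos:
  assumes u: "is_chain X x y N u" and "x \<noteq> y"
  shows "0 < chain_sum D N u"
proof (rule ccontr)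
  assume "\<not> 0 < chain_sum D N u"
  then have "chain_sum D N u = 0" using chain_sum_nonneg[OF u] by linarith
  moreover have "\<And>i. i \<in> {1..N - 1} \<Longrightarrow> 0 \<le> D (u i) (u (i + 1))"
    using u unfolding is_chain_def by (intro D_nonneg) auto
  ultimately have z: "\<forall>i\<in>{1..N - 1}. D (u i) (u (i + 1)) = 0"
    unfolding chain_sum_def by (subst (asm) sum_nonneg_eq_0_iff) auto
  have e: "u i = u (Suc i)" if "1 \<le> i" "i < N" for i
    using z D1[of "u i" "u (i + 1)"] u that unfolding is_chain_def by auto
  have "1 \<le> j \<Longrightarrow> j \<le> N \<Longrightarrow> u j = u 1" for j
  proof (induction j rule: dec_induct)
    case (step n) then show ?case using e[of n] by auto
  qed simp
  from this[of N] show False using u \<open>x \<noteq> y\<close> unfolding is_chain_def by auto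
qed

lemma ex_chain: "x \<in> X \<Longrightarrow> y \<in> X \<Longrightarrow> is_chain X x y 2 (\<lambda>i. if i = 1 then x else y)"
  unfolding is_chain_def by auto

lemma chain_dist_le:
  assumes u: "is_chain X x y N u" shows "chain_dist X D x y \<le> chain_sum D N u"
proof -
  have "x \<in> X" "y \<in> X" using u unfolding is_chain_def by auto
  moreover have "bdd_below {chain_sum D N u |N u. is_chain X x y N u}"
    by (rule bdd_belowI[of _ 0]) (auto intro: chain_sum_nonneg)
  ultimately show ?thesis unfolding chain_dist_def using u by (auto intro!: cInf_lower)
qed

lemma chain_dist_greatest:
  assumes "x \<in> X" "y \<in> X" "\<And>N u. is_chain X x y N u \<Longrightarrow> c \<le> chain_sum D N u"
  shows "c \<le> chain_dist X D x y"
  unfolding chain_dist_def using assms ex_chain[of x y] by (auto intro!: cInf_greatest)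

lemma chain_rev:
  assumes u: "is_chain X x y N u"
  shows "is_chain X y x N (\<lambda>i. u (N + 1 - i))" "chain_sum D N (\<lambda>i. u (N + 1 - i)) = chain_sum D N u"
proof -
  have "u (N + 1 - i) \<in> X" if "i \<in> {1..N}" for i
  proof -
    have "N + 1 - i \<in> {1..N}" using that by auto
    then show ?thesis using u unfolding is_chain_def by blast
  qed
  then show "is_chain X y x N (\<lambda>i. u (N + 1 - i))" using u unfolding is_chain_def by auto
  have "(\<Sum>i = 1..N - 1. D (u (N + 1 - i)) (u (N + 1 - (i + 1)))) = (\<Sum>i = 1..N - 1. D (u i) (u (i + 1)))"
  proof (rule sum.reindex_bij_witness[of _ "\<lambda>i. N - i" "\<lambda>i. N - i"])
    fix i assume i: "i \<in> {1..N - 1}"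
    have "D (u (N - i)) (u (N - i + 1)) = D (u (N - i + 1)) (u (N - i))"
      using i u unfolding is_chain_def by (intro D2) auto
    then show "D (u (N - i)) (u (N - i + 1)) = D (u (N + 1 - i)) (u (N + 1 - (i + 1)))"
      using i by (auto simp: Suc_diff_le)
  qed auto
  then show "chain_sum D N (\<lambda>i. u (N + 1 - i)) = chain_sum D N u"
    unfolding chain_sum_def .
qed

lemma chain_append:
  assumes u: "is_chain X x y N u" and v: "is_chain X y z M v"
  shows "\<exists>K w. is_chain X x z K w \<and> chain_sum D K w = chain_sum D N u + chain_sum D M v"
proof -
  define w where "w = (\<lambda>i. if i \<le> N then u i else v (i + 1 - N))"
  have w2: "w (N + i) = v (Suc i)" for i
    using u v unfolding w_def is_chain_def by (cases i) auto
  have "w i \<in> X" if "i \<in> {1..N + M - 1}" for i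
  proof (cases "i \<le> N")
    case True
    then show ?thesis using u that unfolding w_def is_chain_def by auto
  next
    case False
    then have "i + 1 - N \<in> {1..M}" using that by auto
    then show ?thesis using False v unfolding w_def is_chain_def by auto
  qed
  then have c: "is_chain X x z (N + M - 1) w"
    using u v w2[of "M - 1"] unfolding is_chain_def by (auto simp: w_def)
  have split_sum: "(\<Sum>i<a + b. g i) = (\<Sum>i<a. g i) + (\<Sum>i<b. g (a + i))"
    for a b and g :: "nat \<Rightarrow> real"
    by (induction b) auto
  have N2: "2 \<le> N" "2 \<le> M" using u v unfolding is_chain_def by auto
  have *: "chain_sum D K h = (\<Sum>i<K - 1. D (h (Suc i)) (h (Suc (Suc i))))" for K h
    unfolding chain_sum_def
    by (rule sum.reindex_bij_witness[of _ "\<lambda>i. Suc i" "\<lambda>i. i - 1"]) auto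
  have "chain_sum D (N + M - 1) w = (\<Sum>i<(N - 1) + (M - 1). D (w (Suc i)) (w (Suc (Suc i))))"
    using N2 unfolding * by (intro sum.cong) auto
  also have "\<dots> = (\<Sum>i<N - 1. D (w (Suc i)) (w (Suc (Suc i)))) +
      (\<Sum>i<M - 1. D (w (Suc (N - 1 + i))) (w (Suc (Suc (N - 1 + i)))))"
    using split_sum by (simp only: add_Suc_right)
  also have "(\<Sum>i<N - 1. D (w (Suc i)) (w (Suc (Suc i)))) = chain_sum D N u"
    unfolding * by (intro sum.cong) (auto simp: w_def)
  also have "(\<Sum>i<M - 1. D (w (Suc (N - 1 + i))) (w (Suc (Suc (N - 1 + i))))) = chain_sum D M v"
    unfolding * using N2 w2[of "i" for i] w2[of "Suc i" for i] by (intro sum.cong) auto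
  finally show ?thesis using c by blast
qed

theorem Metric_space_chain_dist: "Metric_space X (chain_dist X D)"
proof
  show nn: "0 \<le> chain_dist X D x y" for x y
    using chain_dist_greatest[of x y 0] chain_sum_nonneg by (cases "x \<in> X \<and> y \<in> X") (auto simp: chain_dist_def)
  have le: "chain_dist X D x y \<le> chain_dist X D y x" if "x \<in> X" "y \<in> X" for x y
    using that chain_dist_le chain_rev by (intro chain_dist_greatest) metis+
  show "chain_dist X D x y = chain_dist X D y x" for x y
    using le[of x y] le[of y x] by (cases "x \<in> X \<and> y \<in> X") (auto simp: chain_dist_def)
  show "chain_dist X D x z \<le> chain_dist X D x y + chain_dist X D y z"
    if "x \<in> X" "y \<in> X" "z \<in> X" for x y z
  proof -
    have "chain_dist X D x z - chain_sum D N u \<le> chain_dist X D y z" if u: "is_chain X x y N u" for N u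
    proof (rule chain_dist_greatest)
      fix M v assume v: "is_chain X y z M v"
      from chain_append[OF u v] chain_dist_le
      show "chain_dist X D x z - chain_sum D N u \<le> chain_sum D M v" by fastforce
    qed fact+
    then have "chain_dist X D x z - chain_dist X D y z \<le> chain_dist X D x y"
      using that by (intro chain_dist_greatest) (auto simp: algebra_simps)
    then show ?thesis by linarith
  qed
  show "chain_dist X D x y = 0 \<longleftrightarrow> x = y" if x: "x \<in> X" and y: "y \<in> X" for x y
  proof
    assume "x = y"
    then have "chain_dist X D x y \<le> 0"
      using chain_dist_le[OF ex_chain[OF x y]] D1[OF x x] by (simp add: chain_sum_def)
    then show "chain_dist X D x y = 0" using nn[of x y] by linarith
  next
    assume 0: "chain_dist X D x y = 0"
    show "x = y"
    proof (rule ccontr)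
      assume ne: "x \<noteq> y"
      have "\<exists>t. 0 < t \<and> t < 1 / Suc n \<and> f (D x y) \<le> f t + \<alpha>" for n
      proof -
        have "\<exists>N u. is_chain X x y N u \<and> chain_sum D N u < 1 / Suc n"
        proof (rule ccontr)
          assume "\<not> ?thesis"
          then have "1 / Suc n \<le> chain_dist X D x y"
            by (intro chain_dist_greatest[OF x y]) (meson not_le)
          moreover have "(0::real) < 1 / Suc n" by simp
          ultimately show False using 0 by linarith
        qed
        moreover have "0 < D x y" using D_nonneg[OF x y] D1[OF x y] ne by linarith
        ultimately show ?thesis using chain_sum_pos[OF _ ne] D3[OF x y] by blast
      qed
      then obtain t :: "nat \<Rightarrow> real"
        where t: "\<And>n. 0 < t n" "\<And>n. t n < 1 / Suc n" "\<And>n. f (D x y) \<le> f (t n) + \<alpha>"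
        by metis
      have "(\<lambda>n. 1 / real (Suc n)) \<longlonglongrightarrow> 0" by (rule LIMSEQ_Suc[OF lim_1_over_n])
      then have "t \<longlonglongrightarrow> 0"
        by (rule tendsto_sandwich[rotated 3, where f = "\<lambda>_. 0"])
          (use t in \<open>auto intro!: always_eventually less_imp_le\<close>)
      then have "filterlim (\<lambda>n. f (t n)) at_bot sequentially"
        using f_class t(1) unfolding F_class_def by blast
      then have "eventually (\<lambda>n. f (t n) < f (D x y) - \<alpha>) sequentially"
        by (simp add: filterlim_at_bot_dense)
      then obtain n where "f (t n) < f (D x y) - \<alpha>"
        using eventually_happens trivial_limit_sequentially by blast
      then show False using t(3)[of n] by linarith
    qed
  qed
qed

end

end

theory Submission
  imports Defs
begin

text \<open>
  The chain metric \<open>d\<close> and the map \<open>D\<close> are uniformly equivalent on \<open>X\<close>, and all three claims depend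
  only on uniform equivalence. One direction is the bound \<open>d \<le> D\<close>, which the two-point chain gives
  (\<open>chain_dist_le_D\<close>). The other is a form of continuity at zero: for each \<open>\<epsilon> > 0\<close> there is a
  \<open>\<delta> > 0\<close>, the same for all pairs of points, such that \<open>d x y < \<delta>\<close> implies \<open>D x y < \<epsilon>\<close>
  (\<open>D_small_if_chain_dist_small\<close>). Indeed \<open>d x y < \<delta>\<close> gives a chain whose sum \<open>s\<close> is below \<open>\<delta>\<close>; as
  \<open>f\<close> tends to \<open>-\<infinity>\<close> at \<open>0\<close>, the number \<open>f s + \<alpha>\<close> is below \<open>f \<epsilon>\<close> once \<open>\<delta>\<close> is small, and then the
  chain inequality together with the monotonicity of \<open>f\<close> rules out \<open>D x y \<ge> \<epsilon>\<close>.

  Consequently \<open>D\<close> and \<open>d\<close> have the same Cauchy sequences (\<open>F_Cauchy_iff_MCauchy\<close>). Moreover, each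
  ball of one contains a concentric ball of the other, so the two topologies are equal
  (\<open>F_topology_eq_mtopology\<close>) and the notions of convergence agree. Completeness is expressed by
  Cauchy and convergent sequences alone.
\<close>

text \<open>
  The second axiom on \<open>f\<close> speaks of sequences; this is its consequence in terms of a threshold: if no
  \<open>\<delta>\<close> worked, a point of \<open>(0, 1/(n+1))\<close> violating the bound for each \<open>n\<close> would form a null sequence
  along which \<open>f\<close> stays bounded below.
\<close>

lemma F_class_below_near_0:
  assumes "f \<in> F_class"
  shows "\<exists>\<delta>>0. \<forall>t. 0 < t \<longrightarrow> t < \<delta> \<longrightarrow> f t < c"
proof (rule ccontr)
  assume contra: "\<not> ?thesis"
  have "\<exists>t. 0 < t \<and> t < 1 / real (Suc n) \<and> c \<le> f t" for n
  proof -
    have "0 < 1 / real (Suc n)" by simp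
    then show ?thesis using contra by (meson not_le)
  qed
  then obtain t :: "nat \<Rightarrow> real"
    where t: "\<And>n. 0 < t n" "\<And>n. t n < 1 / real (Suc n)" "\<And>n. c \<le> f (t n)"
    by metis
  have "(\<lambda>n. 1 / real (Suc n)) \<longlonglongrightarrow> 0" by (rule LIMSEQ_Suc[OF lim_1_over_n])
  then have "t \<longlonglongrightarrow> 0"
    by (rule tendsto_sandwich[rotated 3, where f = "\<lambda>_. 0"])
      (use t in \<open>auto intro!: always_eventually less_imp_le\<close>)
  then have "filterlim (\<lambda>n. f (t n)) at_bot sequentially"
    using assms t(1) unfolding F_class_def by blast
  then have "eventually (\<lambda>n. f (t n) < c) sequentially"
    by (simp add: filterlim_at_bot_dense)
  then obtain n where "f (t n) < c"
    using eventually_happens trivial_limit_sequentially by blast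
  then show False using t(3)[of n] by linarith
qed

context F_metric_space
begin

interpretation Metric_space X "chain_dist X D"
  by (rule Metric_space_chain_dist)

lemma chain_dist_le_D:
  assumes "x \<in> X" "y \<in> X"
  shows "chain_dist X D x y \<le> D x y"
  using chain_dist_le[OF ex_chain[OF assms]] by (simp add: chain_sum_def)

lemma chain_below:
  assumes "x \<in> X" "y \<in> X" "chain_dist X D x y < \<delta>"
  obtains N u where "is_chain X x y N u" "chain_sum D N u < \<delta>"
  using chain_dist_greatest[of x y \<delta>] assms by (meson not_le)

text \<open>
  The chain inequality stands in for the triangle inequality, which \<open>D\<close> may violate: it bounds \<open>D\<close>
  at the ends of a chain by the sum along the chain. The threshold \<open>\<delta>\<close> is chosen so that \<open>f t + \<alpha> < f \<epsilon>\<close> for \<open>0 < t < \<delta>\<close>; it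
  depends on \<open>f\<close>, \<open>\<alpha>\<close> and \<open>\<epsilon>\<close> only, so the comparison is uniform in \<open>x\<close> and \<open>y\<close>.
\<close>

lemma D_small_if_chain_dist_small:
  assumes "0 < \<epsilon>"
  shows "\<exists>\<delta>>0. \<forall>x\<in>X. \<forall>y\<in>X. chain_dist X D x y < \<delta> \<longrightarrow> D x y < \<epsilon>"
proof -
  obtain \<delta> where "0 < \<delta>" and \<delta>: "\<And>t. 0 < t \<Longrightarrow> t < \<delta> \<Longrightarrow> f t < f \<epsilon> - \<alpha>"
    using F_class_below_near_0[OF f_class] by blast
  have "D x y < \<epsilon>" if xy: "x \<in> X" "y \<in> X" "chain_dist X D x y < \<delta>" for x y
  proof (rule ccontr)
    assume "\<not> D x y < \<epsilon>"
    then have "\<epsilon> \<le> D x y" and "0 < D x y" using \<open>0 < \<epsilon>\<close> by auto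
    then have "x \<noteq> y" using D1[OF xy(1,2)] by auto
    obtain N u where u: "is_chain X x y N u" and less: "chain_sum D N u < \<delta>"
      using chain_below[OF xy] .
    have "f \<epsilon> \<le> f (D x y)"
      using f_class \<open>\<epsilon> \<le> D x y\<close> \<open>0 < \<epsilon>\<close> \<open>0 < D x y\<close> unfolding F_class_def
      by (auto intro: mono_onD)
    also have "\<dots> \<le> f (chain_sum D N u) + \<alpha>"
      using D3[OF xy(1,2) u \<open>0 < D x y\<close>] .
    also have "\<dots> < f \<epsilon>"
      using \<delta>[OF chain_sum_pos[OF u \<open>x \<noteq> y\<close>] less] by linarith
    finally show False by simp
  qed
  then show ?thesis using \<open>0 < \<delta>\<close> by blast
qed

lemma F_Cauchy_iff_MCauchy: "F_Cauchy X D \<sigma> \<longleftrightarrow> MCauchy \<sigma>"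
proof
  assume C: "F_Cauchy X D \<sigma>"
  then have X: "\<And>n. \<sigma> n \<in> X" unfolding F_Cauchy_def by auto
  show "MCauchy \<sigma>"
    using C unfolding MCauchy_def F_Cauchy_def
    by (meson X chain_dist_le_D order_le_less_trans)
next
  assume C: "MCauchy \<sigma>"
  then have X: "\<And>n. \<sigma> n \<in> X" unfolding MCauchy_def by auto
  show "F_Cauchy X D \<sigma>"
    unfolding F_Cauchy_def
  proof (intro conjI allI impI)
    show "range \<sigma> \<subseteq> X" using X by auto
    fix \<epsilon> :: real assume "0 < \<epsilon>"
    then obtain \<delta> where "0 < \<delta>"
      and \<delta>: "\<forall>x\<in>X. \<forall>y\<in>X. chain_dist X D x y < \<delta> \<longrightarrow> D x y < \<epsilon>"
      using D_small_if_chain_dist_small by blast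
    obtain K where "\<forall>n m. K \<le> n \<longrightarrow> K \<le> m \<longrightarrow> chain_dist X D (\<sigma> n) (\<sigma> m) < \<delta>"
      using C \<open>0 < \<delta>\<close> unfolding MCauchy_def by blast
    then show "\<exists>K. \<forall>n\<ge>K. \<forall>m\<ge>K. D (\<sigma> n) (\<sigma> m) < \<epsilon>"
      using \<delta> X by blast
  qed
qed

text \<open>
  The sets \<open>F_ball X D x r\<close> need not be open, but both topologies are determined by concentric balls
  around the points of a set, so mutual inclusion of such balls is enough.
\<close>

lemma F_topology_eq_mtopology: "F_topology X D = mtopology"
proof -
  have F_ball_in_mball: "F_ball X D x r \<subseteq> mball x r" if "x \<in> X" for x r
    using chain_dist_le_D[OF that] that unfolding F_ball_def mball_def
    by (auto intro: order_le_less_trans)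
  have mball_in_F_ball: "\<exists>\<delta>>0. mball x \<delta> \<subseteq> F_ball X D x r" if "0 < r" for x r
    using D_small_if_chain_dist_small[OF that] unfolding F_ball_def mball_def by blast
  have "(\<exists>r>0. F_ball X D x r \<subseteq> V) \<longleftrightarrow> (\<exists>r>0. mball x r \<subseteq> V)" if "x \<in> X" for x V
    using F_ball_in_mball[OF that] mball_in_F_ball by (meson subset_trans)
  then show ?thesis
    unfolding topology_eq openin_F_topology openin_mtopology by blast
qed

lemma F_complete_iff_mcomplete: "F_complete X D \<longleftrightarrow> mcomplete"
proof -
  have "x \<in> X" if "limitin mtopology \<sigma> x sequentially" for \<sigma> x
    using limitin_topspace[OF that] by simp
  then show ?thesis
    unfolding F_complete_def mcomplete_def F_convergent_def F_Cauchy_iff_MCauchy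
      F_topology_eq_mtopology
    by blast
qed

end

theorem theorem2p3:
  fixes X :: "'a set" and D :: "'a \<Rightarrow> 'a \<Rightarrow> real" and f :: "real \<Rightarrow> real" and \<alpha> :: real
  assumes "F_metric_space X D f \<alpha>"
  shows "(\<forall>\<sigma> :: nat \<Rightarrow> 'a. range \<sigma> \<subseteq> X \<longrightarrow>
            (F_Cauchy X D \<sigma> \<longleftrightarrow> Metric_space.MCauchy X (chain_dist X D) \<sigma>)) \<and>
         (\<forall>(\<sigma> :: nat \<Rightarrow> 'a) x. range \<sigma> \<subseteq> X \<longrightarrow> x \<in> X \<longrightarrow>
            (F_convergent X D \<sigma> x \<longleftrightarrow>
             limitin (Metric_space.mtopology X (chain_dist X D)) \<sigma> x sequentially)) \<and>
         (F_complete X D \<longleftrightarrow> Metric_space.mcomplete X (chain_dist X D))"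
proof -
  interpret F_metric_space X D f \<alpha> by (rule assms)
  show ?thesis
    by (simp add: F_Cauchy_iff_MCauchy F_convergent_def F_topology_eq_mtopology
        F_complete_iff_mcomplete)
qed

end
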